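(* Let $n\ge 2$, let $0<\psi\le\pi$, and let $f\in\mathsf{G}_n^+$ with zeroth Gegenbauer coefficient $c_0>0$. Then $$A(n,\psi)\le \frac{h_{max}(n,\cos\psi,f)}{c_0}=\frac{1}{c_0}\max\{h_0,h_1,\ldots,h_\mu\}.$$
   Context: $\mathbf{S}^{n-1}$ is the unit sphere in $\mathbf{R}^n$. A finite subset $X\subset\mathbf{S}^{n-1}$ is a spherical $\psi$-code if $x\cdot y\le\cos\psi$ for all distinct $x,y\in X$. $A(n,\psi)$ is the maximal size of a spherical $\psi$-code in $\mathbf{S}^{n-1}$. The Gegenbauer polynomials $G_k^{(n)}$ (normalized by $G_k^{(n)}(1)=1$) are given by $G_0^{(n)}=1$, $G_1^{(n)}=t$, and $G_k^{(n)}=\dfrac{(2k+n-4)\,t\,G_{k-1}^{(n)}-(k-1)\,G_{k-2}^{(n)}}{k+n-3}$ for $k\ge2$. $\mathsf{G}_n^+$ is the set of continuous functions $f:[-1,1]\to\mathbf{R}$ representable as series $f(t)=\sum_{k=0}^\infty c_kG_k^{(n)}(t)$ with $c_0>0$, $c_k\ge0$ for $k\ge1$, and $f(1)=\sum_{k=0}^\infty c_k<\infty$. Let $z=\cos\psi$ and let $f:[-1,1]\to\mathbf{R}$. Fix $y_0\in\mathbf{S}^{n-1}$. For $m\ge1$ let $Q_m(y_0)$ be the family of all sets $Y=\{y_1,\ldots,y_m\}\subset\mathbf{S}^{n-1}$ such that $y_i\cdot y_j\le z$ for all $0\le i\ne j\le m$ and $f(y_0\cdot y_i)>0$ for $1\le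 i\le m$; for $m=0$ put $Q_0(y_0)=\{y_0\}$ (only the trivial configuration with no further points). Let $\mu=\mu(n,z,f):=\max\{m: Q_m(y_0)\ne\emptyset\}$. Define $H(y_0):=f(1)$ for $m=0$ and $H(y_0;Y):=f(1)+f(y_0\cdot y_1)+\ldots+f(y_0\cdot y_m)$ for $m\ge1$, $Y\in Q_m(y_0)$. For $0\le m\le \mu$ let $h_m=h_m(n,z,f)$ be the supremum of $H$ over $Q_m(y_0)$ (so $h_0=f(1)$), and $h_{max}=h_{max}(n,z,f):=\max\{h_0,h_1,\ldots,h_\mu\}$. By rotational symmetry these quantities do not depend on $y_0$. *)

theory Defs
  imports "HOL-Analysis.Analysis"
begin

definition spherical_code :: "real \<Rightarrow> (real ^ 'n) set \<Rightarrow> bool" where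
  "spherical_code \<psi> X \<longleftrightarrow>
     finite X \<and> X \<subseteq> sphere 0 1 \<and> pairwise (\<lambda>x y. x \<bullet> y \<le> cos \<psi>) X"

text \<open>The dimension \<open>n\<close> is passed as an index type with \<open>CARD('n) = n\<close>. The maximum is
  over a finite set whenever \<open>0 < \<psi> \<le> pi\<close>, by compactness of the sphere.\<close>

definition max_code_size :: "'n::finite itself \<Rightarrow> real \<Rightarrow> nat" where
  "max_code_size _ \<psi> = Max {card X | X :: (real ^ 'n) set. spherical_code \<psi> X}"

text \<open>The last equation is the recurrence
  \<open>G\<^sub>j = ((2 j + n - 4) t G\<^sub>j\<^sub>-\<^sub>1 - (j - 1) G\<^sub>j\<^sub>-\<^sub>2) / (j + n - 3)\<close> for \<open>j = k + 2\<close>.\<close>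

fun gegenbauer :: "nat \<Rightarrow> nat \<Rightarrow> real \<Rightarrow> real" where
  "gegenbauer n 0 t = 1"
| "gegenbauer n (Suc 0) t = t"
| "gegenbauer n (Suc (Suc k)) t =
     ((2 * real k + real n) * t * gegenbauer n (Suc k) t - (real k + 1) * gegenbauer n k t)
       / (real k + real n - 1)"

definition gegenbauer_expansion :: "nat \<Rightarrow> (real \<Rightarrow> real) \<Rightarrow> (nat \<Rightarrow> real) \<Rightarrow> bool" where
  "gegenbauer_expansion n f c \<longleftrightarrow>
     c 0 > 0 \<and> (\<forall>k\<ge>1. c k \<ge> 0) \<and>
     (\<forall>t\<in>{-1..1}. (\<lambda>k. c k * gegenbauer n k t) sums f t) \<and>
     c sums f 1"

text \<open>Functions on \<open>[-1,1]\<close> are represented by total functions; only the values on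
  \<open>{-1..1}\<close> are constrained or used.\<close>

definition G_plus :: "nat \<Rightarrow> (real \<Rightarrow> real) set" where
  "G_plus n = {f. continuous_on {-1..1} f \<and> (\<exists>c. gegenbauer_expansion n f c)}"

text \<open>A configuration \<open>{y\<^sub>1, \<dots>, y\<^sub>m}\<close> is a set of exactly \<open>m\<close> points: for \<open>z < 1\<close> the
  constraints force \<open>y\<^sub>0, \<dots>, y\<^sub>m\<close> to be distinct. For \<open>m = 0\<close> the only
  configuration is the empty set.\<close>

definition Q_family :: "real \<Rightarrow> (real \<Rightarrow> real) \<Rightarrow> real ^ 'n \<Rightarrow> nat \<Rightarrow> (real ^ 'n) set set" where
  "Q_family z f y0 m =
     {Y. finite Y \<and> card Y = m \<and> Y \<subseteq> sphere 0 1 \<and>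
         pairwise (\<lambda>x y. x \<bullet> y \<le> z) Y \<and>
         (\<forall>y\<in>Y. y0 \<bullet> y \<le> z \<and> f (y0 \<bullet> y) > 0)}"

definition H_fun :: "(real \<Rightarrow> real) \<Rightarrow> real ^ 'n \<Rightarrow> (real ^ 'n) set \<Rightarrow> real" where
  "H_fun f y0 Y = f 1 + (\<Sum>y\<in>Y. f (y0 \<bullet> y))"

definition mu :: "real \<Rightarrow> (real \<Rightarrow> real) \<Rightarrow> real ^ 'n \<Rightarrow> nat" where
  "mu z f y0 = Max {m. Q_family z f y0 m \<noteq> {}}"

definition h :: "real \<Rightarrow> (real \<Rightarrow> real) \<Rightarrow> real ^ 'n \<Rightarrow> nat \<Rightarrow> real" where
  "h z f y0 m = (SUP Y\<in>Q_family z f y0 m. H_fun f y0 Y)"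

definition h_max :: "real \<Rightarrow> (real \<Rightarrow> real) \<Rightarrow> real ^ 'n \<Rightarrow> real" where
  "h_max z f y0 = Max (h z f y0 ` {0..mu z f y0})"

end

theory Submission imports Defs begin

text \<open>Summing \<open>f (x \<bullet> y)\<close> over all pairs of points of a code \<open>X\<close> gives at least \<open>c\<^sub>0 |X|\<^sup>2\<close>,
  because every Gegenbauer polynomial is a positive definite kernel on the sphere (Schoenberg).
  Discarding the nonpositive off-diagonal terms of the row of \<open>x\<close> leaves the value of \<open>H\<close> on an
  admissible configuration around \<open>x\<close>, so every row sum is at most \<open>h_max\<close>. Schoenberg's theorem
  is proved by induction on the degree: the zonal kernel of degree \<open>k + 1\<close> is obtained from that of
  degree \<open>k\<close> by applying the same first-order differential operators to both arguments.\<close>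

section \<open>Homogenised Gegenbauer polynomials\<close>

text \<open>With \<open>s = x \<bullet> y\<close> and \<open>q = |x|\<^sup>2 |y|\<^sup>2\<close>, \<open>zonal\<close> is \<open>|x|\<^sup>k |y|\<^sup>k G\<^sub>k(x \<bullet> y / |x||y|)\<close>, a
  polynomial on all of \<open>\<real>\<^sup>n\<close>. Suffixes \<open>s\<close> and \<open>q\<close> denote partial derivatives.\<close>

fun zonal :: "nat \<Rightarrow> nat \<Rightarrow> real \<Rightarrow> real \<Rightarrow> real" where
  "zonal n 0 s q = 1"
| "zonal n (Suc 0) s q = s"
| "zonal n (Suc (Suc k)) s q =
     ((2 * real k + real n) * s * zonal n (Suc k) s q - (real k + 1) * q * zonal n k s q)
       / (real k + real n - 1)"

fun zonal_s :: "nat \<Rightarrow> nat \<Rightarrow> real \<Rightarrow> real \<Rightarrow> real" where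
  "zonal_s n 0 s q = 0"
| "zonal_s n (Suc 0) s q = 1"
| "zonal_s n (Suc (Suc k)) s q =
     ((2 * real k + real n) * (zonal n (Suc k) s q + s * zonal_s n (Suc k) s q)
        - (real k + 1) * q * zonal_s n k s q) / (real k + real n - 1)"

fun zonal_q :: "nat \<Rightarrow> nat \<Rightarrow> real \<Rightarrow> real \<Rightarrow> real" where
  "zonal_q n 0 s q = 0"
| "zonal_q n (Suc 0) s q = 0"
| "zonal_q n (Suc (Suc k)) s q =
     ((2 * real k + real n) * s * zonal_q n (Suc k) s q
        - (real k + 1) * (zonal n k s q + q * zonal_q n k s q)) / (real k + real n - 1)"

fun zonal_ss :: "nat \<Rightarrow> nat \<Rightarrow> real \<Rightarrow> real \<Rightarrow> real" where
  "zonal_ss n 0 s q = 0"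
| "zonal_ss n (Suc 0) s q = 0"
| "zonal_ss n (Suc (Suc k)) s q =
     ((2 * real k + real n) * (2 * zonal_s n (Suc k) s q + s * zonal_ss n (Suc k) s q)
        - (real k + 1) * q * zonal_ss n k s q) / (real k + real n - 1)"

fun zonal_sq :: "nat \<Rightarrow> nat \<Rightarrow> real \<Rightarrow> real \<Rightarrow> real" where
  "zonal_sq n 0 s q = 0"
| "zonal_sq n (Suc 0) s q = 0"
| "zonal_sq n (Suc (Suc k)) s q =
     ((2 * real k + real n) * (zonal_q n (Suc k) s q + s * zonal_sq n (Suc k) s q)
        - (real k + 1) * (zonal_s n k s q + q * zonal_sq n k s q)) / (real k + real n - 1)"

section \<open>Chain rule, homogeneity and degree-raising identities\<close>

lemma zonal_eq_gegenbauer: "zonal n k t 1 = gegenbauer n k t"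
  by (induction n k t rule: gegenbauer.induct) auto

lemma has_real_derivative_zonal:
  assumes "(f has_real_derivative f') (at x)" "(g has_real_derivative g') (at x)"
  shows "((\<lambda>h. zonal n k (f h) (g h)) has_real_derivative
           zonal_s n k (f x) (g x) * f' + zonal_q n k (f x) (g x) * g') (at x)"
proof (induction k rule: induct_nat_012)
  case (ge2 k)
  show ?case
    unfolding zonal.simps zonal_s.simps zonal_q.simps
    by (rule DERIV_cong[OF DERIV_cdivide], (rule derivative_eq_intros refl assms ge2.IH)+)
       (simp add: algebra_simps add_divide_distrib diff_divide_distrib)
qed (auto intro!: derivative_eq_intros assms)

lemma has_real_derivative_zonal_s:
  assumes "(f has_real_derivative f') (at x)" "(g has_real_derivative g') (at x)"
  shows "((\<lambda>h. zonal_s n k (f h) (g h)) has_real_derivative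
           zonal_ss n k (f x) (g x) * f' + zonal_sq n k (f x) (g x) * g') (at x)"
proof (induction k rule: induct_nat_012)
  case (ge2 k)
  show ?case
    unfolding zonal_s.simps zonal_ss.simps zonal_sq.simps
    by (rule DERIV_cong[OF DERIV_cdivide],
        (rule derivative_eq_intros refl assms ge2.IH has_real_derivative_zonal)+)
       (simp add: algebra_simps add_divide_distrib diff_divide_distrib)
qed (auto intro!: derivative_eq_intros assms)

text \<open>Euler's identity: the polynomial is weighted homogeneous of degree \<open>k\<close> when
  \<open>s\<close> has weight 1 and \<open>q\<close> has weight 2. It serves to eliminate
  derivatives in \<open>q\<close>.\<close>

lemma zonal_euler:
  "s * zonal_s n k s q + 2 * q * zonal_q n k s q = real k * zonal n k s q"
proof (induction k rule: induct_nat_012)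
  case (ge2 k)
  let ?A = "2 * real k + real n"
  have "s * (?A * (zonal n (Suc k) s q + s * zonal_s n (Suc k) s q) - (real k + 1) * q * zonal_s n k s q)
     + 2 * q * (?A * s * zonal_q n (Suc k) s q - (real k + 1) * (zonal n k s q + q * zonal_q n k s q))
     = ?A * s * zonal n (Suc k) s q 
       + ?A * s * (s * zonal_s n (Suc k) s q + 2 * q * zonal_q n (Suc k) s q)
       - (real k + 1) * q * (s * zonal_s n k s q + 2 * q * zonal_q n k s q) - 2 * (real k + 1) * q * zonal n k s q"
    by (simp add: algebra_simps)
  also have "\<dots> = real (Suc (Suc k)) * (?A * s * zonal n (Suc k) s q - (real k + 1) * q * zonal n k s q)"
    unfolding ge2.IH by (simp add: algebra_simps)
  finally show ?case
    unfolding zonal.simps zonal_s.simps zonal_q.simps times_divide_eq_right add_divide_distrib [symmetric]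
    by (rule arg_cong)
qed auto

text \<open>Differentiating in \<open>s\<close> lowers the weighted degree by one, hence the factor
  \<open>k - 1\<close>.\<close>

lemma zonal_s_euler:
  "s * zonal_ss n k s q + 2 * q * zonal_sq n k s q = (real k - 1) * zonal_s n k s q"
proof (induction k rule: induct_nat_012)
  case (ge2 k)
  let ?A = "2 * real k + real n"
  have "s * (?A * (2 * zonal_s n (Suc k) s q + s * zonal_ss n (Suc k) s q) - (real k + 1) * q * zonal_ss n k s q)
     + 2 * q * (?A * (zonal_q n (Suc k) s q + s * zonal_sq n (Suc k) s q)
                - (real k + 1) * (zonal_s n k s q + q * zonal_sq n k s q))
     = ?A * s * zonal_s n (Suc k) s q
       + ?A * (s * zonal_s n (Suc k) s q + 2 * q * zonal_q n (Suc k) s q)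
       + ?A * s * (s * zonal_ss n (Suc k) s q + 2 * q * zonal_sq n (Suc k) s q)
       - (real k + 1) * q * (s * zonal_ss n k s q + 2 * q * zonal_sq n k s q)
       - 2 * (real k + 1) * q * zonal_s n k s q"
    by (simp add: algebra_simps)
  also have "\<dots> = (real (Suc (Suc k)) - 1) *
      (?A * (zonal n (Suc k) s q + s * zonal_s n (Suc k) s q) - (real k + 1) * q * zonal_s n k s q)"
    unfolding ge2.IH zonal_euler by (simp add: algebra_simps)
  finally show ?case
    unfolding zonal_s.simps zonal_ss.simps zonal_sq.simps times_divide_eq_right add_divide_distrib [symmetric]
    by (rule arg_cong)
qed auto

text \<open>Each identity needs the other, so both go through one induction. At \<open>q = 1\<close>
  they express the next Gegenbauer polynomial and its derivative through the current ones. Starting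
  at degree 1 keeps \<open>a k\<close> positive: at degree 0 the factor would be
  \<open>n - 2\<close>, which vanishes for \<open>n = 2\<close>.\<close>

lemma zonal_Suc_aux:
  assumes "n \<ge> 2"
  defines "a \<equiv> \<lambda>k. real n + real k - 1"
  shows "a k * s * zonal n (Suc k) s q - (q - s\<^sup>2) * zonal_s n (Suc k) s q = a k * zonal n (Suc (Suc k)) s q
       \<and> a k * zonal_s n (Suc (Suc k)) s q
           = a k * (real k + 2) * zonal n (Suc k) s q + (real k + 2) * s * zonal_s n (Suc k) s q"
proof (induction k)
  case 0
  have "a 0 \<noteq> 0" using assms by (auto simp: a_def)
  then show ?case by (auto simp: a_def field_simps power2_eq_square)
next
  case (Suc k)
  define Z1 Z2 U1 U2 where "Z1 = zonal n (Suc k) s q" and "Z2 = zonal n (Suc (Suc k)) s q"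
    and "U1 = zonal_s n (Suc k) s q" and "U2 = zonal_s n (Suc (Suc k)) s q"
  note defs = Z1_def [symmetric] Z2_def [symmetric] U1_def [symmetric] U2_def [symmetric]
  define b where "b = a k"
  have b: "b > 0" "real n = b + 1 - real k" "a k = b" "a (Suc k) = b + 1"
    using assms by (auto simp: a_def b_def)
  have IH1: "b * s * Z1 - (q - s\<^sup>2) * U1 = b * Z2"
    and IH2: "b * U2 = b * (real k + 2) * Z1 + (real k + 2) * s * U1"
    using Suc unfolding defs b by auto
  have Z3: "(b + 1) * zonal n (Suc (Suc (Suc k))) s q = (b + real k + 3) * s * Z2 - (real k + 2) * q * Z1"
    and U3: "(b + 1) * zonal_s n (Suc (Suc (Suc k))) s q
              = (b + real k + 3) * (Z2 + s * U2) - (real k + 2) * q * U1"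
    using b(1) unfolding zonal.simps(3)[of n "Suc k"] zonal_s.simps(3)[of n "Suc k"] defs b(2)
    by (simp_all add: field_simps)
  \<comment> \<open>Eliminating \<open>U1\<close>, respectively \<open>s * Z1\<close>, from the
    induction hypotheses yields \<open>*\<close> and \<open>**\<close>. With the three-term
    recurrence, \<open>*\<close> gives the first identity one degree higher and \<open>**\<close>
    the second.\<close>
  have "b * ((q - s\<^sup>2) * U2 + (real k + 2) * s * Z2) = b * ((real k + 2) * q * Z1)"
    using IH1 IH2 by algebra
  then have *: "(q - s\<^sup>2) * U2 + (real k + 2) * s * Z2 = (real k + 2) * q * Z1"
    using b(1) by simp
  have **: "b * s * U2 = (real k + 2) * (b * Z2 + q * U1)"
    using IH1 IH2 by algebra
  show ?case
    unfolding b defs Z3 U3 using * ** by (auto simp: algebra_simps)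
qed

lemma zonal_Suc:
  assumes "n \<ge> 2" "k \<ge> 1"
  defines "a \<equiv> real n + real k - 2"
  shows "a * s * zonal n k s q - (q - s\<^sup>2) * zonal_s n k s q = a * zonal n (Suc k) s q"
    and "a * zonal_s n (Suc k) s q = a * (real k + 1) * zonal n k s q + (real k + 1) * s * zonal_s n k s q"
proof -
  obtain j where "k = Suc j" using assms(2) by (cases k) auto
  then show "a * s * zonal n k s q - (q - s\<^sup>2) * zonal_s n k s q = a * zonal n (Suc k) s q"
    and "a * zonal_s n (Suc k) s q = a * (real k + 1) * zonal n k s q + (real k + 1) * s * zonal_s n k s q"
    using zonal_Suc_aux[OF assms(1), of j s q] unfolding a_def by (simp_all add: algebra_simps)
qed

text \<open>Differentiating the first identity of \<open>zonal_Suc\<close> in \<open>s\<close> and eliminating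
  \<open>zonal_s n (Suc k)\<close> with the second one yields the Gegenbauer differential equation.\<close>

lemma zonal_ode:
  assumes "n \<ge> 2" "k \<ge> 1"
  shows "(q - s\<^sup>2) * zonal_ss n k s q
    = (real n - 1) * s * zonal_s n k s q - real k * (real n + real k - 2) * zonal n k s q"
proof -
  let ?a = "real n + real k - 2"
  have "((\<lambda>s. ?a * s * zonal n k s q - (q - s\<^sup>2) * zonal_s n k s q) has_real_derivative
          ?a * zonal n k s q + (?a + 2) * s * zonal_s n k s q - (q - s\<^sup>2) * zonal_ss n k s q) (at s)"
    by (rule derivative_eq_intros refl has_real_derivative_zonal has_real_derivative_zonal_s)+
       (simp add: algebra_simps)
  moreover have "((\<lambda>s. ?a * zonal n (Suc k) s q) has_real_derivative ?a * zonal_s n (Suc k) s q) (at s)"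
    by (rule derivative_eq_intros refl has_real_derivative_zonal)+ simp
  ultimately have "?a * zonal n k s q + (?a + 2) * s * zonal_s n k s q - (q - s\<^sup>2) * zonal_ss n k s q
      = ?a * zonal_s n (Suc k) s q"
    unfolding zonal_Suc(1)[OF assms] by (rule DERIV_unique)
  then show ?thesis
    unfolding zonal_Suc(2)[OF assms] by (simp add: algebra_simps)
qed

section \<open>Gram kernels of polynomial functions\<close>

text \<open>Differential operators must send the factors of a Gram representation to polynomials
  again, so that the next operator can be applied.\<close>

lemma real_polynomial_function_partial_derivative:
  fixes p :: "'a::real_normed_vector \<Rightarrow> real"
  assumes "real_polynomial_function p"
  shows "\<exists>p'. real_polynomial_function p' \<and>
           (\<forall>x. ((\<lambda>h. p (x + h *\<^sub>R e)) has_real_derivative p' x) (at 0))"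
  using assms
proof induction
  case (linear f)
  interpret bounded_linear f by (fact linear)
  have "((\<lambda>h. f (x + h *\<^sub>R e)) has_real_derivative f e) (at 0)" for x
    unfolding add scaleR by (auto intro!: derivative_eq_intros)
  then show ?case by (auto intro!: exI[of _ "\<lambda>_. f e"] real_polynomial_function.intros)
next
  case (const c)
  show ?case by (auto intro!: exI[of _ "\<lambda>_. 0"] real_polynomial_function.intros)
next
  case (add f g)
  then obtain f' g' where "real_polynomial_function f'" "real_polynomial_function g'"
    "\<And>x. ((\<lambda>h. f (x + h *\<^sub>R e)) has_real_derivative f' x) (at 0)"
    "\<And>x. ((\<lambda>h. g (x + h *\<^sub>R e)) has_real_derivative g' x) (at 0)" by metis
  then show ?case
    by (intro exI[of _ "\<lambda>x. f' x + g' x"]) (auto intro!: real_polynomial_function.intros(3) DERIV_add)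
next
  case (mult f g)
  then obtain f' g' where *: "real_polynomial_function f'" "real_polynomial_function g'"
    "\<And>x. ((\<lambda>h. f (x + h *\<^sub>R e)) has_real_derivative f' x) (at 0)"
    "\<And>x. ((\<lambda>h. g (x + h *\<^sub>R e)) has_real_derivative g' x) (at 0)" by metis
  have "((\<lambda>h. f (x + h *\<^sub>R e) * g (x + h *\<^sub>R e)) has_real_derivative f' x * g x + g' x * f x) (at 0)" for x
    using DERIV_mult[OF *(3,4)[of x]] by simp
  with * mult.hyps show ?case
    by (intro exI[of _ "\<lambda>x. f' x * g x + g' x * f x"]) (auto intro!: real_polynomial_function.intros(3,4))
qed

text \<open>A positive semidefinite kernel of finite rank, given by an explicit factorisation. The
  factors are polynomials so that they can be differentiated any number of times; a list allows
  repeated factors.\<close>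

definition gram_kernel :: "('a::real_normed_vector \<Rightarrow> 'a \<Rightarrow> real) \<Rightarrow> bool" where
  "gram_kernel K \<longleftrightarrow> (\<exists>L. (\<forall>p\<in>set L. real_polynomial_function p) \<and>
      (\<forall>x y. K x y = (\<Sum>p\<leftarrow>L. p x * p y)))"

text \<open>Each factor \<open>p\<close> contributes the square of its sum over
  \<open>X\<close>.\<close>

lemma gram_kernel_nonneg:
  assumes "gram_kernel K"
  shows "(\<Sum>x\<in>X. \<Sum>y\<in>X. K x y) \<ge> 0"
proof -
  from assms obtain L where L: "\<And>x y. K x y = (\<Sum>p\<leftarrow>L. p x * p y)"
    by (auto simp: gram_kernel_def)
  have "(\<Sum>x\<in>X. \<Sum>y\<in>X. \<Sum>p\<leftarrow>L. p x * p y) = (\<Sum>p\<leftarrow>L. (\<Sum>x\<in>X. p x)\<^sup>2)"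
    by (induction L) (simp_all add: sum.distrib power2_eq_square sum_product)
  also have "\<dots> \<ge> 0" by (rule sum_list_nonneg) auto
  finally show ?thesis by (simp add: L)
qed

lemma gram_kernel_single: "real_polynomial_function p \<Longrightarrow> gram_kernel (\<lambda>x y. p x * p y)"
  unfolding gram_kernel_def by (rule exI[of _ "[p]"]) auto

lemma gram_kernel_add:
  assumes "gram_kernel K" "gram_kernel K'"
  shows "gram_kernel (\<lambda>x y. K x y + K' x y)"
proof -
  from assms obtain L L' where
    "\<forall>p\<in>set L. real_polynomial_function p" "\<And>x y. K x y = (\<Sum>p\<leftarrow>L. p x * p y)"
    "\<forall>p\<in>set L'. real_polynomial_function p" "\<And>x y. K' x y = (\<Sum>p\<leftarrow>L'. p x * p y)"
    unfolding gram_kernel_def by auto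
  then show ?thesis unfolding gram_kernel_def by (intro exI[of _ "L @ L'"]) auto
qed

lemma gram_kernel_sum:
  assumes "\<And>i. i \<in> A \<Longrightarrow> gram_kernel (K i)"
  shows "gram_kernel (\<lambda>x y. \<Sum>i\<in>A. K i x y)"
  using assms
proof (induction A rule: infinite_finite_induct)
  case (insert i A)
  then show ?case using gram_kernel_add[of "K i" "\<lambda>x y. \<Sum>i\<in>A. K i x y"] by simp
qed (auto simp: gram_kernel_def intro!: exI[of _ "[]"])

lemma gram_kernel_cmult:
  assumes "gram_kernel K" "r \<ge> 0"
  shows "gram_kernel (\<lambda>x y. r * K x y)"
proof -
  from assms obtain L where
    L: "\<forall>p\<in>set L. real_polynomial_function p" "\<And>x y. K x y = (\<Sum>p\<leftarrow>L. p x * p y)"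
    unfolding gram_kernel_def by auto
  \<comment> \<open>The weight \<open>r\<close> is split evenly between the two arguments.\<close>
  have "sqrt r * u * (sqrt r * v) = r * (u * v)" for u v
    using real_sqrt_mult_self[of r] assms(2) by (simp add: mult_ac)
  then have "(\<Sum>p\<leftarrow>L. sqrt r * p x * (sqrt r * p y)) = r * K x y" for x y
    unfolding L(2) by (simp only: sum_list_const_mult)
  with L(1) show ?thesis unfolding gram_kernel_def
    by (intro exI[of _ "map (\<lambda>p x. sqrt r * p x) L"])
       (auto intro!: real_polynomial_function.intros(2,4) simp: comp_def)
qed

section \<open>Differential operators acting on Gram kernels\<close>

lemma has_real_derivative_sum_list:
  assumes "\<And>p. p \<in> set L \<Longrightarrow> (f p has_real_derivative f' p) (at x within S)"
  shows "((\<lambda>h. \<Sum>p\<leftarrow>L. f p h) has_real_derivative (\<Sum>p\<leftarrow>L. f' p)) (at x within S)"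
  using assms
proof (induction L)
  case (Cons p L)
  then show ?case using DERIV_add[of "f p" "f' p" x S "\<lambda>h. \<Sum>p\<leftarrow>L. f p h"] by simp
qed simp

text \<open>The kernel \<open>K\<^sub>2\<close> arises by applying the same first-order operator
  \<open>D p = u p - v \<partial>\<^sub>e p\<close> to both arguments of \<open>K\<close>.\<close>

lemma gram_kernel_diff_op:
  fixes K :: "'a::real_normed_vector \<Rightarrow> 'a \<Rightarrow> real"
  assumes "gram_kernel K" "real_polynomial_function u" "real_polynomial_function v"
    and dx: "\<And>x y. ((\<lambda>h. K (x + h *\<^sub>R e) y) has_real_derivative Kx x y) (at 0)"
    and K1: "\<And>x y. K1 x y = u x * K x y - v x * Kx x y"
    and dy: "\<And>x y. ((\<lambda>h. K1 x (y + h *\<^sub>R e)) has_real_derivative Ky x y) (at 0)"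
    and K2: "\<And>x y. K2 x y = u y * K1 x y - v y * Ky x y"
  shows "gram_kernel K2"
proof -
  from assms obtain L where
    L: "\<forall>p\<in>set L. real_polynomial_function p" "\<And>x y. K x y = (\<Sum>p\<leftarrow>L. p x * p y)"
    unfolding gram_kernel_def by auto
  have "\<forall>p\<in>set L. \<exists>p'. real_polynomial_function p' \<and>
           (\<forall>x. ((\<lambda>h. p (x + h *\<^sub>R e)) has_real_derivative p' x) (at 0))"
    using L(1) real_polynomial_function_partial_derivative by blast
  then obtain d where d: "\<And>p. p \<in> set L \<Longrightarrow> real_polynomial_function (d p)"
     "\<And>p x. p \<in> set L \<Longrightarrow> ((\<lambda>h. p (x + h *\<^sub>R e)) has_real_derivative d p x) (at 0)"
    by metis
  define D where "D = (\<lambda>p x. u x * p x - v x * d p x)"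
  \<comment> \<open>The same derivative is computed from the factorisation; uniqueness of
    derivatives then identifies it with the given closed form \<open>Kx\<close>. The second argument
    is treated likewise.\<close>
  have "((\<lambda>h. K (x + h *\<^sub>R e) y) has_real_derivative (\<Sum>p\<leftarrow>L. d p x * p y)) (at 0)" for x y
    unfolding L(2) by (intro has_real_derivative_sum_list DERIV_cmult_right d)
  then have Kx: "Kx x y = (\<Sum>p\<leftarrow>L. d p x * p y)" for x y
    using dx DERIV_unique by blast
  have K1': "K1 x y = (\<Sum>p\<leftarrow>L. D p x * p y)" for x y
    unfolding K1 Kx L(2) D_def
    by (simp add: sum_list_const_mult [symmetric] sum_list_subtractf [symmetric] algebra_simps)
  have "((\<lambda>h. K1 x (y + h *\<^sub>R e)) has_real_derivative (\<Sum>p\<leftarrow>L. D p x * d p y)) (at 0)" for x y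
    unfolding K1' by (intro has_real_derivative_sum_list DERIV_cmult d)
  then have Ky: "Ky x y = (\<Sum>p\<leftarrow>L. D p x * d p y)" for x y
    using dy DERIV_unique by blast
  have "K2 x y = (\<Sum>p\<leftarrow>L. D p x * D p y)" for x y
    unfolding K2 Ky K1' D_def
    by (simp add: sum_list_const_mult [symmetric] sum_list_subtractf [symmetric] algebra_simps)
  moreover have "real_polynomial_function (D p)" if "p \<in> set L" for p
    unfolding D_def using L(1) d(1) assms(2,3) that
    by (intro real_polynomial_function_diff real_polynomial_function.intros(4)) auto
  ultimately show ?thesis
    unfolding gram_kernel_def by (intro exI[of _ "map D L"]) (auto simp: comp_def)
qed

section \<open>Positive definiteness of Gegenbauer polynomials\<close>

lemma real_polynomial_function_nth: "real_polynomial_function (\<lambda>x :: real ^ 'n. x $ i)"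
  by (rule real_polynomial_function.intros) (rule bounded_linear_vec_nth)

lemma gram_kernel_inner: "gram_kernel (\<lambda>x y :: real ^ 'n. x \<bullet> y)"
  unfolding inner_vec_def inner_real_def
  by (intro gram_kernel_sum gram_kernel_single real_polynomial_function_nth)

lemma real_polynomial_function_inner_self: "real_polynomial_function (\<lambda>x :: real ^ 'n. x \<bullet> x)"
  unfolding inner_vec_def inner_real_def
  by (intro real_polynomial_function_sum real_polynomial_function.intros(4) real_polynomial_function_nth)
     auto

text \<open>In coordinates, \<open>D\<^sub>i = (n + 2 k - 2) x\<^sub>i - |x|\<^sup>2 \<partial>\<^sub>i\<close> maps harmonic polynomials of degree \<open>k\<close>
  to harmonic polynomials of degree \<open>k + 1\<close>. Applying \<open>D\<^sub>i\<close> to both arguments of the zonal kernel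
  of degree \<open>k\<close> and summing over \<open>i\<close> gives a positive multiple of the one of degree \<open>k + 1\<close>.\<close>

lemma gram_kernel_zonal_Suc:
  fixes k :: nat
  defines "n \<equiv> CARD('n)"
  defines "K \<equiv> \<lambda>k (x :: real ^ 'n) y. zonal n k (x \<bullet> y) ((x \<bullet> x) * (y \<bullet> y))"
  assumes n: "n \<ge> 2" and k: "k \<ge> 1" and "gram_kernel (K k)"
  shows "gram_kernel (K (Suc k))"
proof -
  define a where "a = real n + real k - 2"
  define c where "c = real n + 2 * real k - 2"
  have ac: "a > 0" "c > 0" "c = a + real k" using n k by (auto simp: a_def c_def)
  define U where "U = (\<lambda>x y :: real ^ 'n. zonal_s n k (x \<bullet> y) ((x \<bullet> x) * (y \<bullet> y)))"
  define V where "V = (\<lambda>x y :: real ^ 'n. zonal_q n k (x \<bullet> y) ((x \<bullet> x) * (y \<bullet> y)))"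
  define W where "W = (\<lambda>x y :: real ^ 'n. zonal_ss n k (x \<bullet> y) ((x \<bullet> x) * (y \<bullet> y)))"
  define S where "S = (\<lambda>x y :: real ^ 'n. zonal_sq n k (x \<bullet> y) ((x \<bullet> x) * (y \<bullet> y)))"
  define Kx where "Kx = (\<lambda>i (x :: real ^ 'n) y. U x y * y $ i + V x y * (2 * x $ i * (y \<bullet> y)))"
  \<comment> \<open>This is the operator applied in \<open>x\<close>, with \<open>V\<close> already
    removed by Euler's identity and \<open>c - k = a\<close>. Differentiating it in \<open>y\<close>
    therefore requires no second derivative in \<open>q\<close>.\<close>
  define K1 where "K1 = (\<lambda>i (x :: real ^ 'n) y.
      a * x $ i * K k x y + (x $ i * (x \<bullet> y) - (x \<bullet> x) * y $ i) * U x y)"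
  define Ky where "Ky = (\<lambda>i (x :: real ^ 'n) y.
      a * x $ i * (U x y * x $ i + V x y * (2 * y $ i * (x \<bullet> x)))
      + (x $ i * x $ i - (x \<bullet> x)) * U x y
      + (x $ i * (x \<bullet> y) - (x \<bullet> x) * y $ i) * (W x y * x $ i + S x y * (2 * y $ i * (x \<bullet> x))))"
  define K2 where "K2 = (\<lambda>i (x :: real ^ 'n) y. c * y $ i * K1 i x y - (y \<bullet> y) * Ky i x y)"
  have euler: "2 * (x \<bullet> x) * (y \<bullet> y) * V x y = real k * K k x y - (x \<bullet> y) * U x y"
    and euler': "2 * (x \<bullet> x) * (y \<bullet> y) * S x y = (real k - 1) * U x y - (x \<bullet> y) * W x y" for x y
    using zonal_euler[of "x \<bullet> y" n k "(x \<bullet> x) * (y \<bullet> y)"] zonal_s_euler[of "x \<bullet> y" n k "(x \<bullet> x) * (y \<bullet> y)"]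
    unfolding U_def V_def W_def S_def K_def by (auto simp: algebra_simps)
  have deriv_inner: "((\<lambda>h. (x + h *\<^sub>R axis i 1) \<bullet> y) has_real_derivative y $ i) (at 0)"
    and deriv_inner': "((\<lambda>h. x \<bullet> (y + h *\<^sub>R axis i 1)) has_real_derivative x $ i) (at 0)"
    and deriv_norm: "((\<lambda>h. (x + h *\<^sub>R axis i 1) \<bullet> (x + h *\<^sub>R axis i 1)) has_real_derivative 2 * x $ i) (at 0)"
    for x y :: "real ^ 'n" and i
    by (auto simp: inner_add_left inner_add_right inner_axis inner_axis' inner_axis_axis intro!: derivative_eq_intros)
  have deriv_nth: "((\<lambda>h. (y + h *\<^sub>R axis i 1) $ i) has_real_derivative 1) (at 0)" for y :: "real ^ 'n" and i
    by (auto intro!: derivative_eq_intros)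
  have dx: "((\<lambda>h. K k (x + h *\<^sub>R axis i 1) y) has_real_derivative Kx i x y) (at 0)" for x y i
    using has_real_derivative_zonal[OF deriv_inner[of x i y] DERIV_cmult_right[OF deriv_norm[of x i], of "y \<bullet> y"], of n k]
    unfolding K_def Kx_def U_def V_def by simp
  have dyK: "((\<lambda>h. K k x (y + h *\<^sub>R axis i 1)) has_real_derivative
                 U x y * x $ i + V x y * (2 * y $ i * (x \<bullet> x))) (at 0)" for x y i
    using has_real_derivative_zonal[OF deriv_inner'[of x y i] DERIV_cmult[OF deriv_norm[of y i], of "x \<bullet> x"], of n k]
    unfolding K_def U_def V_def by (simp add: mult_ac)
  have dyU: "((\<lambda>h. U x (y + h *\<^sub>R axis i 1)) has_real_derivative
                 W x y * x $ i + S x y * (2 * y $ i * (x \<bullet> x))) (at 0)" for x y i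
    using has_real_derivative_zonal_s[OF deriv_inner'[of x y i] DERIV_cmult[OF deriv_norm[of y i], of "x \<bullet> x"], of n k]
    unfolding U_def W_def S_def by (simp add: mult_ac)
  have dy: "((\<lambda>h. K1 i x (y + h *\<^sub>R axis i 1)) has_real_derivative Ky i x y) (at 0)" for x y i
    unfolding K1_def Ky_def
    by (rule dyK dyU deriv_inner' deriv_nth derivative_eq_intros refl)+ (simp add: algebra_simps)
  have K1: "K1 i x y = c * x $ i * K k x y - (x \<bullet> x) * Kx i x y" for x y i
  proof -
    have "(x \<bullet> x) * Kx i x y = (x \<bullet> x) * y $ i * U x y + x $ i * (2 * (x \<bullet> x) * (y \<bullet> y) * V x y)"
      by (simp add: Kx_def algebra_simps)
    then show ?thesis unfolding euler K1_def ac(3) by (simp add: algebra_simps)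
  qed
  have gram: "gram_kernel (K2 i)" for i
    by (rule gram_kernel_diff_op[OF assms(5) _ _ dx[of _ i] K1[of i] dy[of i]])
       (auto simp: K2_def intro!: real_polynomial_function.intros(2,4) real_polynomial_function_nth
          real_polynomial_function_inner_self)
  have "(\<Sum>i\<in>UNIV. K2 i x y) = c * a * K (Suc k) x y" for x y
  proof -
    define s X Y where "s = x \<bullet> y" and "X = x \<bullet> x" and "Y = y \<bullet> y"
    \<comment> \<open>Coefficients of \<open>K2 i x y\<close> as a quadratic form in the coordinates
      \<open>x $ i\<close> and \<open>y $ i\<close>. Summation over \<open>i\<close> turns the
      monomials into \<open>X\<close>, \<open>s\<close>, \<open>Y\<close> and the constant term into
      \<open>n\<close> copies of itself.\<close>
    define A B C where
      "A = - Y * ((a + 1) * U x y + s * W x y)"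
      and "B = c * a * K k x y + c * s * U x y - a * (2 * X * Y * V x y) - s * (2 * X * Y * S x y) + X * Y * W x y"
      and "C = X * (2 * X * Y * S x y - c * U x y)"
    have "K2 i x y = A * (x $ i * x $ i) + B * (x $ i * y $ i) + C * (y $ i * y $ i) + X * Y * U x y" for i
      unfolding K2_def K1_def Ky_def A_def B_def C_def s_def [symmetric] X_def [symmetric] Y_def [symmetric]
      by (simp add: algebra_simps)
    then have "(\<Sum>i\<in>UNIV. K2 i x y) = A * X + B * s + C * Y + real n * (X * Y * U x y)"
      by (simp add: sum.distrib sum_distrib_left [symmetric] inner_vec_def s_def X_def Y_def n_def)
    also have "\<dots> = c * (a * s * K k x y - (X * Y - s\<^sup>2) * U x y)"
    proof -
      \<comment> \<open>The Euler identities remove \<open>V\<close> and \<open>S\<close>, and the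
        differential equation removes \<open>W\<close>; what remains is the degree-raising
        formula.\<close>
      have ode: "(X * Y - s\<^sup>2) * W x y = (real n - 1) * s * U x y - real k * a * K k x y"
        using zonal_ode[OF n k, of "X * Y" s] unfolding K_def U_def W_def s_def X_def Y_def a_def by simp
      have n': "real n = a + 2 - real k" by (simp add: a_def)
      have V: "2 * X * Y * V x y = real k * K k x y - s * U x y"
        and S: "2 * X * Y * S x y = (real k - 1) * U x y - s * W x y"
        using euler[of x y] euler'[of x y] by (simp_all add: s_def X_def Y_def)
      show ?thesis
        using ode unfolding A_def B_def C_def V S ac(3) n' by algebra
    qed
    also have "\<dots> = c * (a * K (Suc k) x y)"
      using zonal_Suc(1)[OF n k, of s "X * Y"]
      unfolding K_def U_def s_def X_def Y_def a_def by simp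
    finally show ?thesis by simp
  qed
  then have "K (Suc k) = (\<lambda>x y. (1 / (c * a)) * (\<Sum>i\<in>UNIV. K2 i x y))"
    using ac by auto
  then show ?thesis
    using gram_kernel_cmult[OF gram_kernel_sum[of UNIV K2], of "1 / (c * a)"] gram ac by auto
qed

text \<open>The operators are used only from degree 1 on: for \<open>n = 2\<close> the normalising
  constant of the step from degree 0 would vanish. Degree 1 is the inner product itself.\<close>

lemma gram_kernel_zonal:
  assumes "CARD('n) \<ge> 2"
  shows "gram_kernel (\<lambda>x y :: real ^ 'n. zonal CARD('n) k (x \<bullet> y) ((x \<bullet> x) * (y \<bullet> y)))"
proof (induction k rule: induct_nat_012)
  case 0
  show ?case using gram_kernel_single[OF real_polynomial_function.intros(2)[of 1]] by simp
next
  case 1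
  show ?case by (simp add: gram_kernel_inner)
next
  case (ge2 k)
  show ?case by (rule gram_kernel_zonal_Suc[OF assms _ ge2.IH(2)]) simp
qed

lemma gegenbauer_sum_nonneg:
  fixes X :: "(real ^ 'n) set"
  assumes "CARD('n) \<ge> 2" "X \<subseteq> sphere 0 1"
  shows "(\<Sum>x\<in>X. \<Sum>y\<in>X. gegenbauer CARD('n) k (x \<bullet> y)) \<ge> 0"
proof -
  have "x \<bullet> x = 1" if "x \<in> X" for x
    using that assms(2) by (auto simp: dot_square_norm)
  then show ?thesis
    using gram_kernel_nonneg[OF gram_kernel_zonal[OF assms(1), of k], of X]
    by (simp add: zonal_eq_gegenbauer)
qed

text \<open>Summing the expansion over all pairs gives a series with nonnegative terms. Its term of
  degree 0 alone is the left-hand side, since the polynomial of degree 0 is constantly 1.\<close>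

lemma gegenbauer_expansion_sum_ge:
  fixes X :: "(real ^ 'n) set"
  assumes "CARD('n) \<ge> 2" "X \<subseteq> sphere 0 1" "gegenbauer_expansion CARD('n) f c"
  shows "c 0 * (real (card X))\<^sup>2 \<le> (\<Sum>x\<in>X. \<Sum>y\<in>X. f (x \<bullet> y))"
proof -
  have "x \<bullet> y \<in> {-1..1}" if "x \<in> X" "y \<in> X" for x y
    using Cauchy_Schwarz_ineq2[of x y] that assms(2) by (auto simp: abs_le_iff subset_iff)
  then have "(\<lambda>k. \<Sum>x\<in>X. \<Sum>y\<in>X. c k * gegenbauer CARD('n) k (x \<bullet> y)) sums (\<Sum>x\<in>X. \<Sum>y\<in>X. f (x \<bullet> y))"
    using assms(3) unfolding gegenbauer_expansion_def by (intro sums_sum) auto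
  then have sums: "(\<lambda>k. c k * (\<Sum>x\<in>X. \<Sum>y\<in>X. gegenbauer CARD('n) k (x \<bullet> y))) sums
      (\<Sum>x\<in>X. \<Sum>y\<in>X. f (x \<bullet> y))"
    by (simp add: sum_distrib_left)
  have "c k \<ge> 0" for k
    using assms(3) unfolding gegenbauer_expansion_def by (cases k) auto
  then have "(\<Sum>k\<in>{0}. c k * (\<Sum>x\<in>X. \<Sum>y\<in>X. gegenbauer CARD('n) k (x \<bullet> y)))
      \<le> (\<Sum>k. c k * (\<Sum>x\<in>X. \<Sum>y\<in>X. gegenbauer CARD('n) k (x \<bullet> y)))"
    using gegenbauer_sum_nonneg[OF assms(1,2)] sums
    by (intro sum_le_suminf) (auto simp: sums_iff)
  with sums show ?thesis by (simp add: sums_iff power2_eq_square)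
qed

section \<open>Spherical codes\<close>

lemma cos_less_1: "0 < \<psi> \<Longrightarrow> \<psi> \<le> pi \<Longrightarrow> cos \<psi> < 1"
  using cos_monotone_0_pi[of 0 \<psi>] by simp

text \<open>The sphere is totally bounded, and a ball of radius below half the least distance in a
  code contains at most one of its points.\<close>

lemma spherical_code_card_bounded:
  assumes "cos \<psi> < 1"
  obtains N where "\<And>X :: (real ^ 'n) set. spherical_code \<psi> X \<Longrightarrow> card X \<le> N"
proof -
  \<comment> \<open>Half the chord at angle \<psi>: unit vectors satisfy
    \<open>(dist x y)^2 = 2 - 2 * (x \<bullet> y)\<close>.\<close>
  define \<epsilon> where "\<epsilon> = sqrt (2 * (1 - cos \<psi>)) / 2"
  have "\<epsilon> > 0" using assms by (simp add: \<epsilon>_def)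
  then obtain C :: "(real ^ 'n) set" where C: "finite C" "sphere 0 1 \<subseteq> (\<Union>x\<in>C. ball x \<epsilon>)"
    using compact_sphere[of "0 :: real ^ 'n" 1] unfolding compact_eq_totally_bounded by meson
  have "card X \<le> card C" if X: "spherical_code \<psi> X" for X :: "(real ^ 'n) set"
  proof -
    have "\<forall>x\<in>X. \<exists>a\<in>C. x \<in> ball a \<epsilon>"
      using X C(2) unfolding spherical_code_def by blast
    then obtain g where g: "\<And>x. x \<in> X \<Longrightarrow> g x \<in> C \<and> dist (g x) x < \<epsilon>"
      by (metis mem_ball)
    have "inj_on g X"
    proof (rule inj_onI, rule ccontr)
      fix x y assume xy: "x \<in> X" "y \<in> X" "g x = g y" "x \<noteq> y"
      then have "x \<bullet> y \<le> cos \<psi>" "norm x = 1" "norm y = 1"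
        using X by (auto simp: spherical_code_def pairwise_def)
      then have "2 * (1 - cos \<psi>) \<le> (dist x y)\<^sup>2"
        by (simp add: dist_norm power2_norm_eq_inner inner_diff_left inner_diff_right inner_commute)
           (simp add: dot_square_norm)
      then have "2 * \<epsilon> \<le> dist x y"
        by (simp add: \<epsilon>_def real_le_lsqrt)
      moreover have "dist x y < 2 * \<epsilon>"
        using g[OF xy(1)] g[OF xy(2)] xy(3) dist_triangle_less_add[of x "g x" \<epsilon> y \<epsilon>]
        by (simp add: dist_commute)
      ultimately show False by simp
    qed
    with g C(1) show ?thesis by (intro card_inj_on_le[of g]) auto
  qed
  then show ?thesis using that by blast
qed

text \<open>Every configuration is itself a spherical code. Finiteness is what makes the
  \<open>Max\<close> in \<open>mu\<close> a genuine maximum.\<close>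

lemma finite_Q_family_indices:
  fixes y0 :: "real ^ 'n"
  assumes "cos \<psi> < 1"
  shows "finite {m. Q_family (cos \<psi>) f y0 m \<noteq> {}}"
proof -
  obtain N where N: "\<And>X :: (real ^ 'n) set. spherical_code \<psi> X \<Longrightarrow> card X \<le> N"
    using spherical_code_card_bounded[OF assms] by blast
  have "{m. Q_family (cos \<psi>) f y0 m \<noteq> {}} \<subseteq> {..N}"
    using N by (fastforce simp: Q_family_def spherical_code_def)
  then show ?thesis by (rule finite_subset) simp
qed

text \<open>Continuity on the compact interval bounds \<open>f\<close>, so the supremum in
  \<open>h\<close> is a genuine least upper bound whenever configurations exist.\<close>

lemma bdd_above_H_fun:
  fixes y0 :: "real ^ 'n"
  assumes "continuous_on {-1..1} f" "y0 \<in> sphere 0 1"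
  shows "bdd_above (H_fun f y0 ` Q_family z f y0 m)"
proof -
  have "bdd_above (f ` {-1..1})"
    using compact_continuous_image[OF assms(1)] by (simp add: compact_imp_bounded bounded_imp_bdd_above)
  then obtain B where B: "\<And>t. t \<in> {-1..1} \<Longrightarrow> f t \<le> B"
    by (meson bdd_above.unfold imageI)
  have "H_fun f y0 Y \<le> f 1 + real m * B" if Y: "Y \<in> Q_family z f y0 m" for Y
  proof -
    have "f (y0 \<bullet> y) \<le> B" if "y \<in> Y" for y
      using Cauchy_Schwarz_ineq2[of y0 y] that Y assms(2)
      by (intro B) (auto simp: Q_family_def subset_iff abs_le_iff)
    then have "(\<Sum>y\<in>Y. f (y0 \<bullet> y)) \<le> real (card Y) * B"
      by (rule sum_bounded_above)
    with Y show ?thesis by (simp add: H_fun_def Q_family_def)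
  qed
  then show ?thesis by (auto simp: bdd_above_def)
qed

section \<open>Row sums of a code and rotational symmetry\<close>

lemma H_fun_le_h_max:
  fixes y0 :: "real ^ 'n"
  assumes "cos \<psi> < 1" "continuous_on {-1..1} f" "y0 \<in> sphere 0 1"
    and Y: "Y \<in> Q_family (cos \<psi>) f y0 m"
  shows "H_fun f y0 Y \<le> h_max (cos \<psi>) f y0"
proof -
  have "H_fun f y0 Y \<le> h (cos \<psi>) f y0 m"
    unfolding h_def by (intro cSUP_upper Y bdd_above_H_fun assms)
  also have "m \<le> mu (cos \<psi>) f y0"
    unfolding mu_def using Y by (intro Max_ge finite_Q_family_indices assms) auto
  then have "h (cos \<psi>) f y0 m \<le> h_max (cos \<psi>) f y0"
    unfolding h_max_def by (intro Max_ge) auto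
  finally show ?thesis .
qed

text \<open>Lets configurations around an arbitrary code point be compared with the quantities
  defined at the fixed base point \<open>y0\<close>.\<close>

lemma Q_family_orthogonal_image:
  fixes g :: "real ^ 'n \<Rightarrow> real ^ 'n"
  assumes g: "orthogonal_transformation g" and Y: "Y \<in> Q_family z f x m"
  shows "g ` Y \<in> Q_family z f (g x) m" and "H_fun f (g x) (g ` Y) = H_fun f x Y"
proof -
  have inner: "g u \<bullet> g v = u \<bullet> v" for u v
    using g by (simp add: orthogonal_transformation_def)
  have inj: "inj_on g Y"
    using orthogonal_transformation_inj[OF g] inj_on_subset by blast
  show "g ` Y \<in> Q_family z f (g x) m"
    using Y inj orthogonal_transformation_norm[OF g]
    by (auto simp: Q_family_def inner card_image pairwise_def)
  show "H_fun f (g x) (g ` Y) = H_fun f x Y"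
    using inj by (simp add: H_fun_def sum.reindex inner)
qed

lemma code_row_sum_le_h_max:
  fixes X :: "(real ^ 'n) set" and y0 :: "real ^ 'n"
  assumes "cos \<psi> < 1" "continuous_on {-1..1} f" "y0 \<in> sphere 0 1"
    and X: "spherical_code \<psi> X" and x: "x \<in> X"
  shows "(\<Sum>y\<in>X. f (x \<bullet> y)) \<le> h_max (cos \<psi>) f y0"
proof -
  \<comment> \<open>The point \<open>x\<close> is left out because its own term supplies
    \<open>f 1\<close>. The set may be empty, which is the case \<open>m = 0\<close>.\<close>
  define Y where "Y = {y \<in> X - {x}. f (x \<bullet> y) > 0}"
  have fin: "finite X" and norm: "norm x = 1"
    using X x by (auto simp: spherical_code_def)
  have Y: "Y \<in> Q_family (cos \<psi>) f x (card Y)"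
    using X x unfolding Y_def Q_family_def spherical_code_def pairwise_def by auto
  obtain g where g: "orthogonal_transformation g" "g x = y0"
    using orthogonal_transformation_exists_1[of x y0] norm assms(3) by auto
  have "(\<Sum>y\<in>X. f (x \<bullet> y)) = f 1 + (\<Sum>y\<in>X - {x}. f (x \<bullet> y))"
    using fin x norm by (simp add: sum.remove[of X x] dot_square_norm)
  also have "(\<Sum>y\<in>X - {x}. f (x \<bullet> y)) \<le> (\<Sum>y\<in>X - {x}. if f (x \<bullet> y) > 0 then f (x \<bullet> y) else 0)"
    by (rule sum_mono) auto
  also have "\<dots> = (\<Sum>y\<in>Y. f (x \<bullet> y))"
    using fin unfolding Y_def by (subst sum.inter_filter) auto
  also have "f 1 + \<dots> = H_fun f y0 (g ` Y)"
    using Q_family_orthogonal_image(2)[OF g(1) Y] by (simp add: g(2) H_fun_def)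
  also have "\<dots> \<le> h_max (cos \<psi>) f y0"
    using Q_family_orthogonal_image(1)[OF g(1) Y] g(2) H_fun_le_h_max[OF assms(1-3)] by blast
  finally show ?thesis by simp
qed

section \<open>Comparison of the two estimates of the double sum\<close>

theorem theorem1:
  fixes \<psi> :: real and f :: "real \<Rightarrow> real" and c :: "nat \<Rightarrow> real" and y0 :: "real ^ 'n"
  assumes "CARD('n) \<ge> 2"
    and "0 < \<psi>" and "\<psi> \<le> pi"
    and "f \<in> G_plus CARD('n)"
    and "gegenbauer_expansion CARD('n) f c"
    and "y0 \<in> sphere 0 1"
  shows "real (max_code_size TYPE('n) \<psi>) \<le> h_max (cos \<psi>) f y0 / c 0"
proof -
  let ?S = "{card X | X :: (real ^ 'n) set. spherical_code \<psi> X}"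
  have cos: "cos \<psi> < 1" using assms(2,3) by (rule cos_less_1)
  obtain N where N: "\<And>X :: (real ^ 'n) set. spherical_code \<psi> X \<Longrightarrow> card X \<le> N"
    using spherical_code_card_bounded[OF cos] by blast
  then have fin: "finite ?S" by (auto intro!: finite_subset[of ?S "{..N}"])
  \<comment> \<open>A singleton code shows that the maximum is over a nonempty set and that an
    optimal code is nonempty, so a factor \<open>card X\<close> can be cancelled at the end.\<close>
  have "spherical_code \<psi> {y0}" using assms(6) by (simp add: spherical_code_def)
  then have one: "1 \<in> ?S" by (intro CollectI exI[of _ "{y0}"]) auto
  have "Max ?S \<in> ?S" using fin one by (intro Max_in) auto
  then obtain X :: "(real ^ 'n) set" where X: "spherical_code \<psi> X" "card X = max_code_size TYPE('n) \<psi>"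
    unfolding max_code_size_def by auto
  have "card X \<ge> 1" using Max_ge[OF fin one] X(2) unfolding max_code_size_def by simp
  have cont: "continuous_on {-1..1} f" using assms(4) by (simp add: G_plus_def)
  have "c 0 * (real (card X))\<^sup>2 \<le> (\<Sum>x\<in>X. \<Sum>y\<in>X. f (x \<bullet> y))"
    using X(1) by (intro gegenbauer_expansion_sum_ge assms) (simp add: spherical_code_def)
  also have "\<dots> \<le> real (card X) * h_max (cos \<psi>) f y0"
    by (intro sum_bounded_above code_row_sum_le_h_max cos cont assms(6) X(1))
  finally have "real (card X) * (c 0 * real (card X)) \<le> real (card X) * h_max (cos \<psi>) f y0"
    by (simp add: power2_eq_square mult_ac)
  then have "c 0 * real (card X) \<le> h_max (cos \<psi>) f y0"
    using \<open>card X \<ge> 1\<close> by (subst (asm) mult_le_cancel_left_pos) auto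
  moreover have "c 0 > 0" using assms(5) by (simp add: gegenbauer_expansion_def)
  ultimately show ?thesis unfolding X(2) [symmetric] by (simp add: field_simps)
qed

end
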